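(* Let $(G,H)=(G,\cdot,H,\star,\odot)$ be a bracoid containing a brace, and let $\lambda,\rho$ be the functions defined by $\lambda_x(y)=(x\odot e)^{-\star}\star(x\odot(y\odot e))$ and $\rho_y(x)=\lambda_x(y)^{-1}xy$ for $x,y\in G$. Then the function $\tilde r:G\times G\to G\times G$ defined by $$\tilde r(x,y)=(\lambda_x(y),\rho_y(x))$$ is a right nondegenerate solution of the set-theoretic Yang--Baxter equation on $G$.
   Context: Bracoid (= left skew bracoid): a quintuple $(G,\cdot,N,\star,\odot)$, abbreviated $(G,N)$, where $(G,\cdot)$ and $(N,\star)$ are groups and $\odot$ is a transitive left action of $(G,\cdot)$ on the set $N$ with $x\odot(\eta\star\mu)=(x\odot\eta)\star(x\odot e_N)^{-\star}\star(x\odot\mu)$ for all $x\in G$, $\eta,\mu\in N$ (here $^{-\star}$ is inversion with respect to $\star$). It contains a brace if there is a subgroup $H$ of $(G,\cdot)$ such that the restricted action makes $(H,N)$ a bracoid with $\mathrm{Stab}_H(e_N)$ trivial (equivalently, $H$ acts regularly on $N$). Convention: a bracoid containing a brace is written $(G,\cdot,H,\star,\odot)$ with $H\le(G,\cdot)$ the subgroup in that definition, the additive group having been identified with $H$ through $h\mapsto h\odot e_N$. Thus the identity $e$ of $G$ is also the identity of $(H,\star)$, and $h\odot e=h$ for all $h\in H$ (hence $h\odot k=hk$ for $h,k\in H$). In terms of the homomorphism $\gamma:G\to\mathrm{Aut}(H,\star)$, $\gamma_x(h)=(x\odot e)^{-\star}\star(x\odot h)$, one has $\lambda_x(y)=\gamma_x(y\odot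 e)\in H\subseteq G$. Products written by juxtaposition and inverses $^{-1}$ are taken in $(G,\cdot)$. A solution of the set-theoretic Yang--Baxter equation on a nonempty set $G$ is a map $r:G\times G\to G\times G$ with $(r\times\mathrm{id})(\mathrm{id}\times r)(r\times\mathrm{id})=(\mathrm{id}\times r)(r\times\mathrm{id})(\mathrm{id}\times r)$ on $G\times G\times G$. A solution written $r(x,y)=(f_x(y),g_y(x))$ is right nondegenerate if $g_y:G\to G$ is bijective for each $y\in G$. *)

theory Defs
  imports "HOL-Algebra.Group_Action"
begin

section \<open>Left skew bracoids\<close>

text \<open>
  As everywhere in \<^theory>\<open>HOL-Algebra.Group_Action\<close>, an action of \<open>G\<close> on a set is a homomorphism
  into the group of (extensional) permutations of that set.
\<close>

locale bracoid = transitive_action G "carrier N" act + N: group N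
  for G :: "('g, 'c) monoid_scheme" (structure)
    and N :: "('n, 'd) monoid_scheme"
    and act :: "'g \<Rightarrow> 'n \<Rightarrow> 'n" (infixr "\<odot>" 75) +
  assumes act_mult:
    "\<lbrakk>x \<in> carrier G; \<eta> \<in> carrier N; \<mu> \<in> carrier N\<rbrakk> \<Longrightarrow>
       x \<odot> (\<eta> \<otimes>\<^bsub>N\<^esub> \<mu>) = (x \<odot> \<eta>) \<otimes>\<^bsub>N\<^esub> inv\<^bsub>N\<^esub> (x \<odot> \<one>\<^bsub>N\<^esub>) \<otimes>\<^bsub>N\<^esub> (x \<odot> \<mu>)"

definition contained_brace ::
    "('g, 'c) monoid_scheme \<Rightarrow> 'g set \<Rightarrow> ('n, 'd) monoid_scheme \<Rightarrow> ('g \<Rightarrow> 'n \<Rightarrow> 'n) \<Rightarrow> bool" where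
  "contained_brace G S N act \<longleftrightarrow>
     subgroup S G \<and>
     bracoid (G\<lparr>carrier := S\<rparr>) N act \<and>
     stabilizer (G\<lparr>carrier := S\<rparr>) act \<one>\<^bsub>N\<^esub> = {\<one>\<^bsub>G\<^esub>}"

text \<open>
  In a bracoid containing a brace, the additive group is identified with the acting regular
  subgroup through \<open>h \<mapsto> h \<odot> e\<close>. So \<open>H\<close> below is the additive group, its carrier is a subset of
  the carrier of \<open>G\<close>, and the identification is the identity map.
\<close>

locale bracoid_containing_brace = bracoid G H act
  for G :: "('a, 'c) monoid_scheme" (structure)
    and H :: "('a, 'd) monoid_scheme"
    and act :: "'a \<Rightarrow> 'a \<Rightarrow> 'a" (infixr "\<odot>" 75) +
  assumes contained_brace: "contained_brace G (carrier H) H act"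
    and identification: "h \<in> carrier H \<Longrightarrow> h \<odot> \<one>\<^bsub>H\<^esub> = h"
begin

lemma one_H_eq: "\<one>\<^bsub>H\<^esub> = \<one>"
proof -
  have "\<one> \<in> carrier H"
    using contained_brace by (simp add: contained_brace_def subgroup.one_closed)
  then have "\<one> \<odot> \<one>\<^bsub>H\<^esub> = \<one>"
    by (rule identification)
  moreover have "\<one> \<odot> \<one>\<^bsub>H\<^esub> = \<one>\<^bsub>H\<^esub>"
    using id_eq_one by (metis N.one_closed restrict_apply')
  ultimately show ?thesis by simp
qed

end

definition bracoid_lambda ::
    "('a, 'c) monoid_scheme \<Rightarrow> ('a, 'd) monoid_scheme \<Rightarrow> ('a \<Rightarrow> 'a \<Rightarrow> 'a) \<Rightarrow> 'a \<Rightarrow> 'a \<Rightarrow> 'a" where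
  "bracoid_lambda G H act x y = inv\<^bsub>H\<^esub> (act x \<one>\<^bsub>G\<^esub>) \<otimes>\<^bsub>H\<^esub> act x (act y \<one>\<^bsub>G\<^esub>)"

definition bracoid_rho ::
    "('a, 'c) monoid_scheme \<Rightarrow> ('a, 'd) monoid_scheme \<Rightarrow> ('a \<Rightarrow> 'a \<Rightarrow> 'a) \<Rightarrow> 'a \<Rightarrow> 'a \<Rightarrow> 'a" where
  "bracoid_rho G H act y x = inv\<^bsub>G\<^esub> (bracoid_lambda G H act x y) \<otimes>\<^bsub>G\<^esub> x \<otimes>\<^bsub>G\<^esub> y"


section \<open>Set-theoretic solutions of the Yang--Baxter equation\<close>

text \<open>\<open>r \<times> id\<close> and \<open>id \<times> r\<close> on triples, which are nested to the right.\<close>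

definition times_id :: "('a \<times> 'a \<Rightarrow> 'a \<times> 'a) \<Rightarrow> 'a \<times> 'a \<times> 'a \<Rightarrow> 'a \<times> 'a \<times> 'a" where
  "times_id r = (\<lambda>(x, y, z). (fst (r (x, y)), snd (r (x, y)), z))"

definition id_times :: "('a \<times> 'a \<Rightarrow> 'a \<times> 'a) \<Rightarrow> 'a \<times> 'a \<times> 'a \<Rightarrow> 'a \<times> 'a \<times> 'a" where
  "id_times r = map_prod id r"

definition yang_baxter_solution :: "'a set \<Rightarrow> ('a \<times> 'a \<Rightarrow> 'a \<times> 'a) \<Rightarrow> bool" where
  "yang_baxter_solution S r \<longleftrightarrow>
     S \<noteq> {} \<and>
     r \<in> S \<times> S \<rightarrow> S \<times> S \<and>
     (\<forall>t \<in> S \<times> S \<times> S.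
        (times_id r \<circ> id_times r \<circ> times_id r) t = (id_times r \<circ> times_id r \<circ> id_times r) t)"

definition right_nondegenerate :: "'a set \<Rightarrow> ('a \<times> 'a \<Rightarrow> 'a \<times> 'a) \<Rightarrow> bool" where
  "right_nondegenerate S r \<longleftrightarrow> (\<forall>y \<in> S. bij_betw (\<lambda>x. snd (r (x, y))) S S)"

end

theory Submission
  imports Defs
begin

text \<open>
  Write \<open>\<pi>(x) = x \<odot> e\<close>. The bracoid axiom says that the action is affine:
  \<open>x \<odot> \<eta> = \<pi>(x) \<star> \<gamma>\<^sub>x(\<eta>)\<close>, where \<open>\<gamma>\<close> is a homomorphism from \<open>G\<close> to the endomorphisms of the
  additive group (\<open>gamma_mult\<close>, \<open>gamma_comp\<close>), and \<open>\<lambda>\<^sub>x(y) = \<gamma>\<^sub>x(\<pi>(y))\<close>. For \<open>h, k\<close> in \<open>H\<close>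
  the affine formula reads \<open>h k = h \<star> \<gamma>\<^sub>h(k)\<close>. Applying \<open>\<gamma>\<^sub>x\<close> to
  \<open>\<pi>(y z) = \<pi>(y) \<star> \<gamma>\<^sub>y(\<pi>(z))\<close> and rewriting \<open>\<star>\<close> by this relation yields the cocycle
  identity \<open>\<lambda>\<^sub>x(y z) = \<lambda>\<^sub>x(y) \<lambda>\<^bsub>\<rho>\<^sub>y(x)\<^esub>(z)\<close> (\<open>lambda_mult_right\<close>), with the product taken
  in \<open>G\<close>.

  The cocycle identity is equivalent to \<open>\<rho>\<^bsub>y z\<^esub> = \<rho>\<^sub>z \<rho>\<^sub>y\<close>, and \<open>\<rho>\<^sub>e\<close> is the
  identity because \<open>\<lambda>\<^sub>x(e) = e\<close>. So \<open>\<rho>\<close> is a right action of \<open>G\<close> on its own underlying set, and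
  every \<open>\<rho>\<^sub>y\<close> is a bijection, inverted by the action of the group inverse of \<open>y\<close>. This is right
  nondegeneracy.

  For the Yang--Baxter equation the defining property \<open>\<lambda>\<^sub>x(y) \<rho>\<^sub>y(x) = x y\<close> is used in
  three ways. First components agree because \<open>\<lambda>\<^sub>x\<close> depends multiplicatively on \<open>x\<close>; third
  components agree because \<open>\<rho>\<^sub>y\<close> depends anti-multiplicatively on \<open>y\<close>; and both sides preserve
  the product of the three entries, which in a group determines the middle entry from the outer
  two.
\<close>

section \<open>Yang--Baxter solutions from factorizations in a group\<close>

context group
begin

text \<open>
  On triples, the map \<open>(x, y) \<mapsto> (L x y, R y x)\<close> preserves the product of the entries, by the
  hypothesis \<open>factor\<close>. Together with the two multiplicativity hypotheses, which give the outer
  components, this forces the two sides of the Yang--Baxter equation to agree in the middle.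
\<close>

lemma yang_baxter_solution_of_factorization:
  assumes L_closed: "\<And>x y. \<lbrakk>x \<in> carrier G; y \<in> carrier G\<rbrakk> \<Longrightarrow> L x y \<in> carrier G"
    and R_closed: "\<And>x y. \<lbrakk>x \<in> carrier G; y \<in> carrier G\<rbrakk> \<Longrightarrow> R y x \<in> carrier G"
    and factor: "\<And>x y. \<lbrakk>x \<in> carrier G; y \<in> carrier G\<rbrakk> \<Longrightarrow> L x y \<otimes> R y x = x \<otimes> y"
    and L_mult: "\<And>x y z. \<lbrakk>x \<in> carrier G; y \<in> carrier G; z \<in> carrier G\<rbrakk>
      \<Longrightarrow> L (x \<otimes> y) z = L x (L y z)"
    and R_mult: "\<And>x y z. \<lbrakk>x \<in> carrier G; y \<in> carrier G; z \<in> carrier G\<rbrakk>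
      \<Longrightarrow> R (y \<otimes> z) x = R z (R y x)"
  shows "yang_baxter_solution (carrier G) (\<lambda>(x, y). (L x y, R y x))"
proof -
  let ?r = "\<lambda>(x, y). (L x y, R y x)"
  have braid: "(times_id ?r \<circ> id_times ?r \<circ> times_id ?r) (x, y, z) =
      (id_times ?r \<circ> times_id ?r \<circ> id_times ?r) (x, y, z)"
    if [simp]: "x \<in> carrier G" "y \<in> carrier G" "z \<in> carrier G" for x y z
  proof -
    note [simp] = L_closed R_closed
    define a where "a = L (L x y) (L (R y x) z)"
    define b where "b = R (L (R y x) z) (L x y)"
    define c where "c = R z (R y x)"
    define a' where "a' = L x (L y z)"
    define b' where "b' = L (R (L y z) x) (R z y)"
    define c' where "c' = R (R z y) (R (L y z) x)"
    have [simp]: "a \<in> carrier G" "b \<in> carrier G" "c \<in> carrier G"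
        "a' \<in> carrier G" "b' \<in> carrier G" "c' \<in> carrier G"
      by (simp_all add: a_def b_def c_def a'_def b'_def c'_def)
    have "a = L (L x y \<otimes> R y x) z"
      by (simp add: a_def L_mult)
    also have "\<dots> = a'"
      by (simp add: a'_def factor L_mult)
    finally have a: "a = a'" .
    have "c' = R (L y z \<otimes> R z y) x"
      by (simp add: c'_def R_mult)
    also have "\<dots> = c"
      by (simp add: c_def factor R_mult)
    finally have c: "c = c'" by simp
    have "a \<otimes> b \<otimes> c = L x y \<otimes> L (R y x) z \<otimes> R z (R y x)"
      by (simp add: a_def b_def c_def factor)
    also have "\<dots> = L x y \<otimes> (L (R y x) z \<otimes> R z (R y x))"
      by (simp add: m_assoc)
    also have "\<dots> = L x y \<otimes> (R y x \<otimes> z)"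
      by (simp add: factor)
    also have "\<dots> = L x y \<otimes> R y x \<otimes> z"
      by (simp add: m_assoc)
    also have "\<dots> = x \<otimes> (y \<otimes> z)"
      by (simp add: factor m_assoc)
    finally have left: "a \<otimes> b \<otimes> c = x \<otimes> (y \<otimes> z)" .
    have "a' \<otimes> (b' \<otimes> c') = L x (L y z) \<otimes> (R (L y z) x \<otimes> R z y)"
      by (simp add: a'_def b'_def c'_def factor)
    also have "\<dots> = L x (L y z) \<otimes> R (L y z) x \<otimes> R z y"
      by (simp add: m_assoc)
    also have "\<dots> = x \<otimes> L y z \<otimes> R z y"
      by (simp add: factor)
    also have "\<dots> = x \<otimes> (L y z \<otimes> R z y)"
      by (simp add: m_assoc)
    also have "\<dots> = x \<otimes> (y \<otimes> z)"
      by (simp add: factor)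
    finally have "a \<otimes> b' \<otimes> c = a \<otimes> b \<otimes> c"
      using left by (simp add: a c m_assoc)
    then have "b = b'"
      by simp
    with a c show ?thesis
      by (simp add: times_id_def id_times_def a_def b_def c_def a'_def b'_def c'_def)
  qed
  show ?thesis
    unfolding yang_baxter_solution_def
  proof (intro conjI ballI)
    show "carrier G \<noteq> {}"
      using one_closed by blast
    show "?r \<in> carrier G \<times> carrier G \<rightarrow> carrier G \<times> carrier G"
      by (auto simp: L_closed R_closed)
    show "(times_id ?r \<circ> id_times ?r \<circ> times_id ?r) t =
        (id_times ?r \<circ> times_id ?r \<circ> id_times ?r) t"
      if "t \<in> carrier G \<times> carrier G \<times> carrier G" for t
      using that braid by (cases t) blast
  qed
qed

lemma bij_betw_right_action:
  assumes closed: "\<And>x y. \<lbrakk>x \<in> S; y \<in> carrier G\<rbrakk> \<Longrightarrow> R y x \<in> S"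
    and one: "\<And>x. x \<in> S \<Longrightarrow> R \<one> x = x"
    and mult: "\<And>x y z. \<lbrakk>x \<in> S; y \<in> carrier G; z \<in> carrier G\<rbrakk> \<Longrightarrow> R (y \<otimes> z) x = R z (R y x)"
    and y: "y \<in> carrier G"
  shows "bij_betw (R y) S S"
proof (rule bij_betw_byWitness[where f' = "R (inv y)"])
  show "\<forall>x\<in>S. R (inv y) (R y x) = x"
    using mult[OF _ y inv_closed[OF y]] one by (simp add: y)
  show "\<forall>x\<in>S. R y (R (inv y) x) = x"
    using mult[OF _ inv_closed[OF y] y] one by (simp add: y)
qed (auto simp: closed y)

end


section \<open>The linear part of the action\<close>

context bracoid
begin

lemma group_G: "group G"
  using group_hom group_hom.axioms(1) by blast

lemma act_closed [simp]: "\<lbrakk>x \<in> carrier G; \<eta> \<in> carrier N\<rbrakk> \<Longrightarrow> x \<odot> \<eta> \<in> carrier N"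
  using element_image by blast

text \<open>
  The action is affine rather than additive; dividing by the value at the identity leaves its linear
  part.
\<close>

definition gamma :: "'g \<Rightarrow> 'n \<Rightarrow> 'n" where
  "gamma x \<eta> = inv\<^bsub>N\<^esub> (x \<odot> \<one>\<^bsub>N\<^esub>) \<otimes>\<^bsub>N\<^esub> (x \<odot> \<eta>)"

lemma gamma_closed [simp]: "\<lbrakk>x \<in> carrier G; \<eta> \<in> carrier N\<rbrakk> \<Longrightarrow> gamma x \<eta> \<in> carrier N"
  by (simp add: gamma_def)

lemma act_eq_gamma:
  "\<lbrakk>x \<in> carrier G; \<eta> \<in> carrier N\<rbrakk> \<Longrightarrow> x \<odot> \<eta> = (x \<odot> \<one>\<^bsub>N\<^esub>) \<otimes>\<^bsub>N\<^esub> gamma x \<eta>"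
  by (simp add: gamma_def flip: N.m_assoc)

lemma gamma_one [simp]: "x \<in> carrier G \<Longrightarrow> gamma x \<one>\<^bsub>N\<^esub> = \<one>\<^bsub>N\<^esub>"
  by (simp add: gamma_def)

lemma gamma_mult:
  "\<lbrakk>x \<in> carrier G; \<eta> \<in> carrier N; \<mu> \<in> carrier N\<rbrakk>
    \<Longrightarrow> gamma x (\<eta> \<otimes>\<^bsub>N\<^esub> \<mu>) = gamma x \<eta> \<otimes>\<^bsub>N\<^esub> gamma x \<mu>"
  by (simp add: gamma_def act_mult N.m_assoc)

lemma act_mult_gamma:
  assumes "x \<in> carrier G" "\<eta> \<in> carrier N" "\<mu> \<in> carrier N"
  shows "x \<odot> (\<eta> \<otimes>\<^bsub>N\<^esub> \<mu>) = (x \<odot> \<eta>) \<otimes>\<^bsub>N\<^esub> gamma x \<mu>"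
  using assms by (simp add: act_mult gamma_def N.m_assoc)

text \<open>
  The linear part of a composite of affine maps is the composite of the linear parts: expand
  \<open>x \<odot> (y \<odot> \<eta>)\<close> and cancel the translation part.
\<close>

lemma gamma_comp:
  assumes [simp]: "x \<in> carrier G" "y \<in> carrier G" "\<eta> \<in> carrier N"
  shows "gamma (x \<otimes> y) \<eta> = gamma x (gamma y \<eta>)"
proof -
  have "(x \<otimes> y) \<odot> \<eta> = x \<odot> ((y \<odot> \<one>\<^bsub>N\<^esub>) \<otimes>\<^bsub>N\<^esub> gamma y \<eta>)"
    by (simp add: composition_rule flip: act_eq_gamma)
  also have "\<dots> = ((x \<otimes> y) \<odot> \<one>\<^bsub>N\<^esub>) \<otimes>\<^bsub>N\<^esub> gamma x (gamma y \<eta>)"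
    by (simp add: act_mult_gamma composition_rule)
  finally show ?thesis
    by (simp add: gamma_def[of "x \<otimes> y"] composition_rule flip: N.m_assoc)
qed

end


section \<open>The functions lambda and rho of a bracoid containing a brace\<close>

context bracoid_containing_brace
begin

interpretation G: group G
  by (rule group_G)

abbreviation lambda :: "'a \<Rightarrow> 'a \<Rightarrow> 'a" where
  "lambda \<equiv> bracoid_lambda G H (\<odot>)"

abbreviation rho :: "'a \<Rightarrow> 'a \<Rightarrow> 'a" where
  "rho \<equiv> bracoid_rho G H (\<odot>)"

lemma H_subset: "h \<in> carrier H \<Longrightarrow> h \<in> carrier G"
  using contained_brace subgroup.mem_carrier unfolding contained_brace_def by metis

lemma one_in_H [simp]: "\<one> \<in> carrier H"
  using N.one_closed by (simp add: one_H_eq)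

lemma act_one_H: "h \<in> carrier H \<Longrightarrow> h \<odot> \<one> = h"
  using identification by (simp add: one_H_eq)

text \<open>
  The relation between the two group structures on \<open>H\<close>. It comes from the regular action:
  \<open>h k = (h k) \<odot> e = h \<odot> (k \<odot> e) = h \<odot> k\<close>.
\<close>

lemma mult_eq_gamma:
  assumes h: "h \<in> carrier H" and k: "k \<in> carrier H"
  shows "h \<otimes> k = h \<otimes>\<^bsub>H\<^esub> gamma h k"
proof -
  have "h \<otimes> k \<in> carrier H"
    using contained_brace h k subgroup.m_closed unfolding contained_brace_def by metis
  then have "h \<otimes> k = (h \<otimes> k) \<odot> \<one>"
    by (simp add: act_one_H)
  also have "\<dots> = h \<odot> k"
    using h k by (simp add: composition_rule H_subset act_one_H)
  also have "\<dots> = h \<otimes>\<^bsub>H\<^esub> gamma h k"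
    using act_eq_gamma[of h k] h k by (simp add: H_subset identification)
  finally show ?thesis .
qed

lemma lambda_eq_gamma: "lambda x y = gamma x (y \<odot> \<one>)"
  by (simp add: bracoid_lambda_def gamma_def one_H_eq)

lemma lambda_in_H [simp]:
  "\<lbrakk>x \<in> carrier G; y \<in> carrier G\<rbrakk> \<Longrightarrow> lambda x y \<in> carrier H"
  by (simp add: lambda_eq_gamma)

lemma lambda_closed [simp]:
  "\<lbrakk>x \<in> carrier G; y \<in> carrier G\<rbrakk> \<Longrightarrow> lambda x y \<in> carrier G"
  by (simp add: H_subset)

lemma rho_closed [simp]: "\<lbrakk>x \<in> carrier G; y \<in> carrier G\<rbrakk> \<Longrightarrow> rho y x \<in> carrier G"
  by (simp add: bracoid_rho_def)

lemma lambda_mult_rho: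
  "\<lbrakk>x \<in> carrier G; y \<in> carrier G\<rbrakk> \<Longrightarrow> lambda x y \<otimes> rho y x = x \<otimes> y"
  by (simp add: bracoid_rho_def flip: G.m_assoc)

lemma lambda_mult_left:
  "\<lbrakk>x \<in> carrier G; y \<in> carrier G; z \<in> carrier G\<rbrakk>
    \<Longrightarrow> lambda (x \<otimes> y) z = lambda x (lambda y z)"
  by (simp add: lambda_eq_gamma[of "x \<otimes> y"] lambda_eq_gamma[of x] gamma_comp act_one_H)
    (simp add: lambda_eq_gamma)

text \<open>
  The cocycle identity. Both sides equal \<open>\<lambda>\<^sub>x(y) \<star> \<gamma>\<^bsub>x y\<^esub>(z \<odot> e)\<close>: the left-hand side because
  \<open>\<gamma>\<^sub>x\<close> is additive, the right-hand side because \<open>x y = \<lambda>\<^sub>x(y) \<rho>\<^sub>y(x)\<close> turns \<open>\<gamma>\<^bsub>x y\<^esub>\<close> into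
  \<open>\<gamma>\<^sub>h \<gamma>\<^bsub>\<rho>\<^sub>y(x)\<^esub>\<close> with \<open>h = \<lambda>\<^sub>x(y)\<close> in \<open>H\<close>, where \<open>h k = h \<star> \<gamma>\<^sub>h(k)\<close>.
\<close>

lemma lambda_mult_right:
  assumes [simp]: "x \<in> carrier G" "y \<in> carrier G" "z \<in> carrier G"
  shows "lambda x (y \<otimes> z) = lambda x y \<otimes> lambda (rho y x) z"
proof -
  have "lambda x (y \<otimes> z) = gamma x ((y \<odot> \<one>) \<otimes>\<^bsub>H\<^esub> gamma y (z \<odot> \<one>))"
    using act_eq_gamma[of y "z \<odot> \<one>"] by (simp add: lambda_eq_gamma composition_rule one_H_eq)
  also have "\<dots> = lambda x y \<otimes>\<^bsub>H\<^esub> gamma (x \<otimes> y) (z \<odot> \<one>)"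
    by (simp add: gamma_mult gamma_comp lambda_eq_gamma)
  also have "\<dots> = lambda x y \<otimes>\<^bsub>H\<^esub> gamma (lambda x y \<otimes> rho y x) (z \<odot> \<one>)"
    by (simp add: lambda_mult_rho)
  also have "\<dots> = lambda x y \<otimes>\<^bsub>H\<^esub> gamma (lambda x y) (lambda (rho y x) z)"
    by (simp add: gamma_comp lambda_eq_gamma[of "rho y x"])
  also have "\<dots> = lambda x y \<otimes> lambda (rho y x) z"
    by (simp add: mult_eq_gamma)
  finally show ?thesis .
qed

lemma rho_mult:
  assumes [simp]: "x \<in> carrier G" "y \<in> carrier G" "z \<in> carrier G"
  shows "rho (y \<otimes> z) x = rho z (rho y x)"
proof -
  have "lambda x (y \<otimes> z) \<otimes> rho (y \<otimes> z) x = x \<otimes> y \<otimes> z"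
    by (simp add: lambda_mult_rho G.m_assoc)
  also have "\<dots> = lambda x y \<otimes> (rho y x \<otimes> z)"
    by (simp add: lambda_mult_rho flip: G.m_assoc)
  also have "\<dots> = lambda x y \<otimes> (lambda (rho y x) z \<otimes> rho z (rho y x))"
    by (simp add: lambda_mult_rho)
  also have "\<dots> = lambda x (y \<otimes> z) \<otimes> rho z (rho y x)"
    by (simp add: lambda_mult_right G.m_assoc)
  finally show ?thesis
    by simp
qed

lemma rho_one:
  assumes "x \<in> carrier G"
  shows "rho \<one> x = x"
proof -
  have "lambda x \<one> = \<one>"
    using assms gamma_one[of x] by (simp add: lambda_eq_gamma act_one_H one_H_eq)
  with assms show ?thesis
    by (simp add: bracoid_rho_def)
qed

lemma yang_baxter_solution_lambda_rho:
  "yang_baxter_solution (carrier G) (\<lambda>(x, y). (lambda x y, rho y x))"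
  by (rule G.yang_baxter_solution_of_factorization)
    (simp_all add: lambda_mult_rho lambda_mult_left rho_mult)

lemma right_nondegenerate_lambda_rho:
  "right_nondegenerate (carrier G) (\<lambda>(x, y). (lambda x y, rho y x))"
proof -
  have "bij_betw (rho y) (carrier G) (carrier G)" if "y \<in> carrier G" for y
    using that by (intro G.bij_betw_right_action) (simp_all add: rho_one rho_mult)
  then show ?thesis
    by (simp add: right_nondegenerate_def)
qed

end


theorem proposition4p2:
  fixes G :: "('a, 'c) monoid_scheme"
    and H :: "('a, 'd) monoid_scheme"
    and act :: "'a \<Rightarrow> 'a \<Rightarrow> 'a"
  assumes "bracoid_containing_brace G H act"
  defines "r \<equiv> (\<lambda>(x, y). (bracoid_lambda G H act x y, bracoid_rho G H act y x))"
  shows "yang_baxter_solution (carrier G) r \<and> right_nondegenerate (carrier G) r"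
  unfolding r_def
  using bracoid_containing_brace.yang_baxter_solution_lambda_rho[OF assms(1)]
    bracoid_containing_brace.right_nondegenerate_lambda_rho[OF assms(1)]
  by (rule conjI)

end
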